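(* Let $\mathcal{N}$ be a $(\mathrm{Col},\delta)$-sum-GNN with $L\ge1$ layers, where $\sigma_\ell$ is ReLU for each $1\le\ell\le L-1$, and the set of values attained by $\sigma_L$ contains a number strictly less than the threshold $t$ of the classification function $\mathtt{cls}_t$ of $\mathcal{N}$. Let $p\in\{1,\dots,\delta_L\}$ be a channel that is unbounded at layer $L$. Then each Datalog rule $r$ (over the signature of $\mathcal{N}$) with head predicate $U_p$ is unsound for $\mathcal{N}$; that is, there exists a dataset $D$ with $T_r(D)\not\subseteq T_{\mathcal{N}}(D)$.
   Context: **Signature and Datalog.** Fix a finite set $\mathrm{Col}$ of colours and $\delta\in\mathbb{N}$, $\delta\geq 1$. The signature consists of unary predicates $U_1,\dots,U_\delta$ and one binary predicate $R^c$ for each $c\in\mathrm{Col}$, together with a countably infinite set of constants; there is also a countably infinite set of variables. A term is a variable or a constant. An atom is a predicate applied to terms; a literal is an atom or an inequality $t_1\not\approx t_2$ between terms. A fact is an atom without variables; a dataset is a finite set of facts. A rule is $B_1\wedge\dots\wedge B_n\to H$ with body literals $B_i$ and head atom $H$, where every variable of the rule occurs in a body atom and each body inequality mentions two different terms. A substitution $\nu$ maps finitely many variables to constants, and $\alpha\nu$ denotes the result of applying $\nu$ to the literal $\alpha$. For a dataset $D$, write $D\models B$ for a fact $B$ if $B\in D$, and $D\models a_1\not\approx a_2$ for constants $a_1,a_2$ if $a_1\neq a_2$. $T_r(D)$ is the set of all $H\nu$ for substitutions $\nu$ with $D\models B_i\nu$ for all $i$. **Sum-GNNs.** A $(\mathrm{Col},\delta)$-graph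 is $\langle V,\{E^c\}_{c\in\mathrm{Col}},\lambda\rangle$ with $V$ a finite vertex set, $E^c\subseteq V\times V$, and $\lambda(v)\in\mathbb{R}^\delta$ for each $v \in V$. A $(\mathrm{Col},\delta)$-sum-GNN $\mathcal{N}$ with $L\ge1$ layers consists of dimensions $\delta_0,\dots,\delta_L$ with $\delta_0=\delta_L=\delta$ and, for each $\ell\in\{1,\dots,L\}$ and $c\in\mathrm{Col}$, real matrices $\mathbf{A}_\ell,\mathbf{B}^c_\ell$ of size $\delta_\ell\times\delta_{\ell-1}$, a vector $\mathbf{b}_\ell\in\mathbb{R}^{\delta_\ell}$, an activation function $\sigma_\ell:\mathbb{R}\to[0,\infty)$ that is monotonically increasing ($x<y$ implies $\sigma_\ell(x)\le\sigma_\ell(y)$), and a threshold $t\in\mathbb{R}$ with classification function $\mathtt{cls}_t(x)=1$ if $x\ge t$ and $0$ otherwise. Applied to a $(\mathrm{Col},\delta)$-graph it computes, for each vertex $v$, $\mathbf{v}_0=\lambda(v)$ and $$\mathbf{v}_\ell=\sigma_\ell\Big(\mathbf{b}_\ell+\mathbf{A}_\ell\mathbf{v}_{\ell-1}+\sum_{c\in\mathrm{Col}}\mathbf{B}^c_\ell\sum_{(v,u)\in E^c}\mathbf{u}_{\ell-1}\Big),\quad 1\le\ell\le L,$$ (functions applied element-wise). The output is the graph with the same vertices and edges, where $v$ is labelled by $\mathtt{cls}_t(\mathbf{v}_L)$. Each $i\in\{1,\dots,\delta_\ell\}$ is called a channel of layer $\ell$. $\mathrm{ReLU}(x)=\max(x,0)$.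 **Dataset transformation.** The canonical encoding $\mathtt{enc}(D)$ of a dataset $D$ is the graph with a vertex $v_a$ for each constant $a$ in $D$, an edge $(v_a,v_b)\in E^c$ for each $R^c(a,b)\in D$, and initial labels with $p$-th component of $v_a$ equal to $1$ if $U_p(a)\in D$ and $0$ otherwise. The decoder $\mathtt{dec}$ is the inverse: it maps a Boolean-labelled graph to the set of all $R^c(a,b)$ with $(v_a,v_b)\in E^c$ and all $U_p(a)$ with $p$-th label component of $v_a$ equal to $1$. $T_{\mathcal{N}}(D)=\mathtt{dec}(\mathcal{N}(\mathtt{enc}(D)))$. **Unbounded channels.** Channel $p\in\{1,\dots,\delta_L\}$ is unbounded at layer $L$ if there exist a Boolean vector $\mathbf{y}_0\in\{0,1\}^{\delta_0}$ and a sequence $c_1,\dots,c_L$ of (not necessarily distinct) colours in $\mathrm{Col}$ such that, with $\mathbf{y}_\ell:=\mathrm{ReLU}(\mathbf{B}_\ell^{c_\ell}\mathbf{y}_{\ell-1})$ for $1\le\ell\le L-1$, it holds that $(\mathbf{B}_L^{c_L}\mathbf{y}_{L-1})[p]<0$. *)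

theory Defs
  imports Complex_Main "Jordan_Normal_Form.Matrix"
begin

text \<open>
  Colours are the elements of a finite type. Variables and constants are two disjoint
  copies of the natural numbers. The unary predicates \<open>U\<^sub>1, \<dots>, U\<^sub>\<delta>\<close> are written
  \<open>Unary 0, \<dots>, Unary (\<delta> - 1)\<close>, in line with the 0-based components of vectors in the
  matrix library; the bound by \<open>\<delta>\<close> is enforced by \<open>wf_atom\<close>.
\<close>

datatype trm = Var nat | Const nat

datatype 'c atom = Unary nat trm | Binary 'c trm trm

datatype 'c literal = Pos "'c atom" | Neq trm trm

datatype 'c rule = Rule (body: "'c literal list") (head: "'c atom")

fun vars_trm :: "trm \<Rightarrow> nat set" where
  "vars_trm (Var x) = {x}"
| "vars_trm (Const a) = {}"

fun vars_atom :: "'c atom \<Rightarrow> nat set" where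
  "vars_atom (Unary p s) = vars_trm s"
| "vars_atom (Binary c s t) = vars_trm s \<union> vars_trm t"

fun vars_literal :: "'c literal \<Rightarrow> nat set" where
  "vars_literal (Pos A) = vars_atom A"
| "vars_literal (Neq s t) = vars_trm s \<union> vars_trm t"

definition vars_rule :: "'c rule \<Rightarrow> nat set" where
  "vars_rule r = (\<Union>B\<in>set (body r). vars_literal B) \<union> vars_atom (head r)"

fun wf_atom :: "nat \<Rightarrow> 'c atom \<Rightarrow> bool" where
  "wf_atom \<delta> (Unary p s) \<longleftrightarrow> p < \<delta>"
| "wf_atom \<delta> (Binary c s t) \<longleftrightarrow> True"

definition is_fact :: "nat \<Rightarrow> 'c atom \<Rightarrow> bool" where
  "is_fact \<delta> A \<longleftrightarrow> wf_atom \<delta> A \<and> vars_atom A = {}"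

definition is_dataset :: "nat \<Rightarrow> 'c atom set \<Rightarrow> bool" where
  "is_dataset \<delta> D \<longleftrightarrow> finite D \<and> (\<forall>A\<in>D. is_fact \<delta> A)"

definition is_rule :: "nat \<Rightarrow> 'c rule \<Rightarrow> bool" where
  "is_rule \<delta> r \<longleftrightarrow>
     wf_atom \<delta> (head r) \<and>
     (\<forall>A. Pos A \<in> set (body r) \<longrightarrow> wf_atom \<delta> A) \<and>
     (\<forall>s t. Neq s t \<in> set (body r) \<longrightarrow> s \<noteq> t) \<and>
     (\<forall>x\<in>vars_rule r. \<exists>A. Pos A \<in> set (body r) \<and> x \<in> vars_atom A)"

fun consts_trm :: "trm \<Rightarrow> nat set" where
  "consts_trm (Var x) = {}"
| "consts_trm (Const a) = {a}"

fun consts_atom :: "'c atom \<Rightarrow> nat set" where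
  "consts_atom (Unary p s) = consts_trm s"
| "consts_atom (Binary c s t) = consts_trm s \<union> consts_trm t"

text \<open>Substitutions are finite partial maps; variables outside the domain are left unchanged.\<close>

type_synonym subst = "nat \<rightharpoonup> nat"

fun subst_trm :: "subst \<Rightarrow> trm \<Rightarrow> trm" where
  "subst_trm \<nu> (Var x) = (case \<nu> x of None \<Rightarrow> Var x | Some a \<Rightarrow> Const a)"
| "subst_trm \<nu> (Const a) = Const a"

fun subst_atom :: "subst \<Rightarrow> 'c atom \<Rightarrow> 'c atom" where
  "subst_atom \<nu> (Unary p s) = Unary p (subst_trm \<nu> s)"
| "subst_atom \<nu> (Binary c s t) = Binary c (subst_trm \<nu> s) (subst_trm \<nu> t)"

fun subst_literal :: "subst \<Rightarrow> 'c literal \<Rightarrow> 'c literal" where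
  "subst_literal \<nu> (Pos A) = Pos (subst_atom \<nu> A)"
| "subst_literal \<nu> (Neq s t) = Neq (subst_trm \<nu> s) (subst_trm \<nu> t)"

text \<open>
  An inequality holds only between two distinct constants; in particular it does not hold if
  one of its sides is still a variable. A dataset contains no atoms with variables, so
  the same is true for atoms.
\<close>

fun holds :: "'c atom set \<Rightarrow> 'c literal \<Rightarrow> bool" where
  "holds D (Pos A) \<longleftrightarrow> A \<in> D"
| "holds D (Neq s t) \<longleftrightarrow> (\<exists>a b. s = Const a \<and> t = Const b \<and> a \<noteq> b)"

definition T_rule :: "'c rule \<Rightarrow> 'c atom set \<Rightarrow> 'c atom set" where
  "T_rule r D = {subst_atom \<nu> (head r) | \<nu>.
     finite (dom \<nu>) \<and> (\<forall>B\<in>set (body r). holds D (subst_literal \<nu> B))}"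

record ('v, 'c) graph =
  verts :: "'v set"
  edges :: "'c \<Rightarrow> ('v \<times> 'v) set"
  label :: "'v \<Rightarrow> real vec"

definition is_graph :: "nat \<Rightarrow> ('v, 'c) graph \<Rightarrow> bool" where
  "is_graph \<delta> G \<longleftrightarrow>
     finite (verts G) \<and>
     (\<forall>c. edges G c \<subseteq> verts G \<times> verts G) \<and>
     (\<forall>v\<in>verts G. label G v \<in> carrier_vec \<delta>)"

definition relu :: "real \<Rightarrow> real" where
  "relu x = max x 0"

definition cls :: "real \<Rightarrow> real \<Rightarrow> real" where
  "cls t x = (if x \<ge> t then 1 else 0)"

text \<open>
  Layers are numbered from 1; the values of \<open>matA\<close>, \<open>matB\<close>, \<open>bias\<close> and \<open>act\<close> at layers outside
  \<open>{1..n_layers}\<close> are irrelevant. \<open>width N l\<close> is the dimension \<open>\<delta>\<^sub>l\<close>.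
\<close>

record 'c gnn =
  n_layers :: nat
  width :: "nat \<Rightarrow> nat"
  matA :: "nat \<Rightarrow> real mat"
  matB :: "nat \<Rightarrow> 'c \<Rightarrow> real mat"
  bias :: "nat \<Rightarrow> real vec"
  act :: "nat \<Rightarrow> real \<Rightarrow> real"
  threshold :: real

definition is_sum_gnn :: "nat \<Rightarrow> 'c gnn \<Rightarrow> bool" where
  "is_sum_gnn \<delta> N \<longleftrightarrow>
     1 \<le> n_layers N \<and>
     width N 0 = \<delta> \<and> width N (n_layers N) = \<delta> \<and>
     (\<forall>l\<in>{1..n_layers N}.
        matA N l \<in> carrier_mat (width N l) (width N (l - 1)) \<and>
        (\<forall>c. matB N l c \<in> carrier_mat (width N l) (width N (l - 1))) \<and>
        bias N l \<in> carrier_vec (width N l) \<and>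
        mono (act N l) \<and> (\<forall>x. 0 \<le> act N l x))"

primrec feature :: "('c::finite) gnn \<Rightarrow> ('v, 'c) graph \<Rightarrow> nat \<Rightarrow> 'v \<Rightarrow> real vec" where
  "feature N G 0 v = label G v"
| "feature N G (Suc l) v = map_vec (act N (Suc l))
     (bias N (Suc l) + matA N (Suc l) *\<^sub>v feature N G l v +
      finsum_vec TYPE(real) (width N (Suc l))
        (\<lambda>c. matB N (Suc l) c *\<^sub>v
           finsum_vec TYPE(real) (width N l) (\<lambda>u. feature N G l u) {u. (v, u) \<in> edges G c})
        UNIV)"

definition apply_gnn :: "('c::finite) gnn \<Rightarrow> ('v, 'c) graph \<Rightarrow> ('v, 'c) graph" where
  "apply_gnn N G =
     G\<lparr>label := \<lambda>v. map_vec (cls (threshold N)) (feature N G (n_layers N) v)\<rparr>"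

lemma feature_carrier:
  assumes "is_sum_gnn \<delta> N" "is_graph \<delta> G" "l \<le> n_layers N" "v \<in> verts G"
  shows "feature N G l v \<in> carrier_vec (width N l)"
  using assms(3,4)
proof (induction l arbitrary: v)
  case 0
  then show ?case using assms(1,2) by (auto simp: is_sum_gnn_def is_graph_def)
next
  case (Suc l)
  have "finsum_vec TYPE(real) (width N (Suc l))
        (\<lambda>c. matB N (Suc l) c *\<^sub>v
           finsum_vec TYPE(real) (width N l) (\<lambda>u. feature N G l u) {u. (v, u) \<in> edges G c})
        UNIV \<in> carrier_vec (width N (Suc l))"
  proof (rule finsum_vec_closed, rule Pi_I)
    fix c
    have "matB N (Suc l) c \<in> carrier_mat (width N (Suc l)) (width N l)"
      using assms(1) Suc.prems unfolding is_sum_gnn_def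
      by (metis atLeastAtMost_iff diff_Suc_1 le_add1 plus_1_eq_Suc)
    moreover have "finsum_vec TYPE(real) (width N l) (feature N G l) {u. (v, u) \<in> edges G c}
        \<in> carrier_vec (width N l)"
    proof (rule finsum_vec_closed, rule Pi_I)
      fix u assume "u \<in> {u. (v, u) \<in> edges G c}"
      then have "u \<in> verts G" using assms(2) unfolding is_graph_def by blast
      then show "feature N G l u \<in> carrier_vec (width N l)" using Suc.IH Suc.prems(1) by (meson Suc_leD)
    qed
    ultimately show "matB N (Suc l) c *\<^sub>v
           finsum_vec TYPE(real) (width N l) (\<lambda>u. feature N G l u) {u. (v, u) \<in> edges G c}
        \<in> carrier_vec (width N (Suc l))"
      by (rule mult_mat_vec_carrier)
  qed
  then show ?case
    by (intro carrier_vecI) (simp only: feature.simps index_map_vec index_add_vec carrier_vecD)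
qed

text \<open>The vertex \<open>v\<^sub>a\<close> of a constant \<open>a\<close> is \<open>a\<close> itself.\<close>

definition enc :: "nat \<Rightarrow> 'c atom set \<Rightarrow> (nat, 'c) graph" where
  "enc \<delta> D = \<lparr>
     verts = (\<Union>A\<in>D. consts_atom A),
     edges = (\<lambda>c. {(a, b). Binary c (Const a) (Const b) \<in> D}),
     label = (\<lambda>a. vec \<delta> (\<lambda>p. if Unary p (Const a) \<in> D then 1 else 0))\<rparr>"

definition dec :: "(nat, 'c) graph \<Rightarrow> 'c atom set" where
  "dec G =
     {Binary c (Const a) (Const b) | c a b. (a, b) \<in> edges G c} \<union>
     {Unary p (Const a) | p a. a \<in> verts G \<and> p < dim_vec (label G a) \<and> label G a $ p = 1}"

definition T_gnn :: "nat \<Rightarrow> ('c::finite) gnn \<Rightarrow> 'c atom set \<Rightarrow> 'c atom set" where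
  "T_gnn \<delta> N D = dec (apply_gnn N (enc \<delta> D))"

lemma is_graph_enc:
  assumes "is_dataset \<delta> D"
  shows "is_graph \<delta> (enc \<delta> D)"
proof -
  have "finite (consts_trm s)" for s by (cases s) auto
  then have "finite (consts_atom A)" for A :: "'a atom" by (cases A) auto
  then have "finite (\<Union>A\<in>D. consts_atom A)"
    using assms by (auto simp: is_dataset_def)
  moreover have "a \<in> (\<Union>A\<in>D. consts_atom A) \<and> b \<in> (\<Union>A\<in>D. consts_atom A)"
    if "Binary c (Const a) (Const b) \<in> D" for c a b
    using UN_I[OF that, of a consts_atom] UN_I[OF that, of b consts_atom] by simp
  ultimately show ?thesis
    unfolding is_graph_def enc_def graph.simps by (intro conjI allI ballI vec_carrier) auto
qed

primrec relu_chain :: "'c gnn \<Rightarrow> (nat \<Rightarrow> 'c) \<Rightarrow> real vec \<Rightarrow> nat \<Rightarrow> real vec" where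
  "relu_chain N cs y 0 = y"
| "relu_chain N cs y (Suc l) = map_vec relu (matB N (Suc l) (cs (Suc l)) *\<^sub>v relu_chain N cs y l)"

text \<open>Only the values of the colour sequence at \<open>1, \<dots>, n_layers N\<close> matter.\<close>

definition unbounded_channel :: "'c gnn \<Rightarrow> nat \<Rightarrow> bool" where
  "unbounded_channel N p \<longleftrightarrow>
     (\<exists>y cs. y \<in> carrier_vec (width N 0) \<and> (\<forall>i<width N 0. y $ i \<in> {0, 1}) \<and>
        (matB N (n_layers N) (cs (n_layers N)) *\<^sub>v relu_chain N cs y (n_layers N - 1)) $ p < 0)"

end

(*
The rule is instantiated by an injective substitution into fresh constants, which always satisfies
its body and derives U_p(a) for some a. A gadget with d vertices on each level 0, ..., L-1 is
attached to a: every level-(l+1) vertex has a c_(l+1)-edge to each level-l vertex, a itself plays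
the role of level L, and the vertices of level 0 are labelled by y_0. At layer l every feature in
the graph is O(d^l), while the level-l vertices have feature d^l y_l + O(d^(l-1)). Hence the
argument of the last activation at channel p of a is d^L (B_L y_(L-1))[p] + O(d^(L-1)), which tends
to minus infinity, so that a is classified 0 for large d.
*)
theory Submission
  imports Defs "HOL-Library.Nat_Bijection"
begin

section \<open>A layer in coordinates, and bounds for its affine part\<close>

lemma index_mult_mat_vec_sum:
  assumes "A \<in> carrier_mat n m" "x \<in> carrier_vec m" "i < n"
  shows "(A *\<^sub>v x) $ i = (\<Sum>j<m. A $$ (i, j) * x $ j)"
  using assms by (auto simp: scalar_prod_def lessThan_atLeast0 intro!: sum.cong)

text \<open>The vertex's own vector \<open>x\<close> and the neighbour sums \<open>z\<close> are
  free arguments, so that a dominant part can later be subtracted from \<open>z\<close> alone and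
  the rest estimated.\<close>

definition affine :: "('c::finite) gnn \<Rightarrow> nat \<Rightarrow> nat \<Rightarrow> (nat \<Rightarrow> real) \<Rightarrow> ('c \<Rightarrow> nat \<Rightarrow> real) \<Rightarrow> real" where
  "affine N l i x z = bias N (Suc l) $ i + (\<Sum>j<width N l. matA N (Suc l) $$ (i, j) * x j)
     + (\<Sum>c\<in>UNIV. \<Sum>j<width N l. matB N (Suc l) c $$ (i, j) * z c j)"

text \<open>Indexed by the input layer \<open>l\<close>, this is what the activation of layer
  \<open>Suc l\<close> is applied to. It is kept apart from the activation because the asymptotics
  must also cover the last layer, whose activation need not be ReLU.\<close>

definition pre :: "('c::finite) gnn \<Rightarrow> ('v, 'c) graph \<Rightarrow> nat \<Rightarrow> 'v \<Rightarrow> nat \<Rightarrow> real" where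
  "pre N G l v i = affine N l i (\<lambda>j. feature N G l v $ j)
     (\<lambda>c j. \<Sum>u | (v, u) \<in> edges G c. feature N G l u $ j)"

lemma gnn_carriers:
  assumes "is_sum_gnn \<delta> N" "Suc l \<le> n_layers N"
  shows "matA N (Suc l) \<in> carrier_mat (width N (Suc l)) (width N l)"
    and "matB N (Suc l) c \<in> carrier_mat (width N (Suc l)) (width N l)"
    and "bias N (Suc l) \<in> carrier_vec (width N (Suc l))"
proof -
  have "Suc l \<in> {1..n_layers N}" using assms(2) by simp
  with assms(1) show "matA N (Suc l) \<in> carrier_mat (width N (Suc l)) (width N l)"
    "matB N (Suc l) c \<in> carrier_mat (width N (Suc l)) (width N l)"
    "bias N (Suc l) \<in> carrier_vec (width N (Suc l))"
    unfolding is_sum_gnn_def by (metis diff_Suc_1)+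
qed

lemma feature_Suc_index:
  assumes "is_sum_gnn \<delta> N" "is_graph \<delta> G" "Suc l \<le> n_layers N" "v \<in> verts G"
    and "i < width N (Suc l)"
  shows "feature N G (Suc l) v $ i = act N (Suc l) (pre N G l v i)"
proof -
  note carr = gnn_carriers[OF assms(1,3)]
  have fc: "feature N G l u \<in> carrier_vec (width N l)" if "u \<in> verts G" for u
    using feature_carrier[OF assms(1,2) _ that] assms(3) by simp
  \<comment> \<open>\<open>finsum_vec\<close> can be read off componentwise only for finite index
    sets and summands of the right dimension, hence the carrier facts collected here for the inner
    and the outer sum.\<close>
  define S where "S c = finsum_vec TYPE(real) (width N l) (feature N G l) {u. (v, u) \<in> edges G c}" for c
  have out: "{u. (v, u) \<in> edges G c} \<subseteq> verts G" for c
    using assms(2) by (auto simp: is_graph_def)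
  have fin: "finite {u. (v, u) \<in> edges G c}" for c
    using finite_subset[OF out] assms(2) by (auto simp: is_graph_def)
  have fo: "feature N G l \<in> {u. (v, u) \<in> edges G c} \<rightarrow> carrier_vec (width N l)" for c
    using out fc by blast
  have Sc: "S c \<in> carrier_vec (width N l)" for c
    unfolding S_def using fo by (rule finsum_vec_closed)
  have Si: "S c $ j = (\<Sum>u | (v, u) \<in> edges G c. feature N G l u $ j)" if "j < width N l" for c j
    unfolding S_def using fin that fo by (rule index_finsum_vec)
  have Bc: "(\<lambda>c. matB N (Suc l) c *\<^sub>v S c) \<in> UNIV \<rightarrow> carrier_vec (width N (Suc l))"
    using mult_mat_vec_carrier[OF carr(2) Sc] by blast
  define R where "R = finsum_vec TYPE(real) (width N (Suc l)) (\<lambda>c. matB N (Suc l) c *\<^sub>v S c) UNIV"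
  have Rc: "R \<in> carrier_vec (width N (Suc l))"
    unfolding R_def using Bc by (rule finsum_vec_closed)
  have Ri: "R $ i = (\<Sum>c\<in>UNIV. \<Sum>j<width N l. matB N (Suc l) c $$ (i, j) * S c $ j)"
    unfolding R_def index_finsum_vec[OF finite assms(5) Bc]
    by (intro sum.cong refl index_mult_mat_vec_sum[OF carr(2) Sc assms(5)])
  have "feature N G (Suc l) v $ i =
      act N (Suc l) (bias N (Suc l) $ i + (matA N (Suc l) *\<^sub>v feature N G l v) $ i + R $ i)"
    using assms(5) Rc carr(1,3) fc[OF assms(4)] unfolding feature.simps S_def[symmetric] R_def[symmetric]
    by (simp add: carrier_vecD add.assoc)
  also have "bias N (Suc l) $ i + (matA N (Suc l) *\<^sub>v feature N G l v) $ i + R $ i = pre N G l v i"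
    unfolding Ri index_mult_mat_vec_sum[OF carr(1) fc[OF assms(4)] assms(5)] pre_def affine_def
    by (simp add: Si)
  finally show ?thesis .
qed

text \<open>By linearity in \<open>z\<close>, removing a contribution of one colour \<open>c\<close>
  leaves an expression of the same form, to which \<open>affine_bound\<close> applies again.\<close>

lemma affine_diff:
  "affine N l i x z - (\<Sum>j<width N l. matB N (Suc l) c $$ (i, j) * w j) =
   affine N l i x (\<lambda>c' j. z c' j - (if c' = c then w j else 0))"
proof -
  have "(\<Sum>c'\<in>UNIV. \<Sum>j<width N l. matB N (Suc l) c' $$ (i, j) * (if c' = c then w j else 0)) =
      (\<Sum>c'\<in>UNIV. if c' = c then \<Sum>j<width N l. matB N (Suc l) c $$ (i, j) * w j else 0)"
    by (intro sum.cong) auto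
  then show ?thesis
    by (simp add: affine_def right_diff_distrib sum_subtractf)
qed

text \<open>Triangle inequality, with \<open>1 \<le> Z\<close> absorbing the bias. What matters is
  that \<open>W\<close> depends only on \<open>N\<close> and \<open>l\<close>, so it serves all
  graphs at once.\<close>

lemma affine_bound:
  fixes N :: "('c::finite) gnn"
  obtains W where "W \<ge> 0"
    "\<And>i x z Z. \<lbrakk>i < width N (Suc l); 1 \<le> Z; \<And>j. j < width N l \<Longrightarrow> \<bar>x j\<bar> \<le> Z;
      \<And>c j. j < width N l \<Longrightarrow> \<bar>z c j\<bar> \<le> Z\<rbrakk> \<Longrightarrow> \<bar>affine N l i x z\<bar> \<le> W * Z"
proof
  \<comment> \<open>The absolute row sum, bias included; adding these over all rows gives a bound
    uniform in \<open>i\<close>.\<close>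
  define w where "w i = \<bar>bias N (Suc l) $ i\<bar> + (\<Sum>j<width N l. \<bar>matA N (Suc l) $$ (i, j)\<bar>)
     + (\<Sum>c\<in>UNIV. \<Sum>j<width N l. \<bar>matB N (Suc l) c $$ (i, j)\<bar>)" for i
  have w0: "w i \<ge> 0" for i
    unfolding w_def by (intro add_nonneg_nonneg sum_nonneg abs_ge_zero)
  show "sum w {..<width N (Suc l)} \<ge> 0"
    by (intro sum_nonneg w0)
  fix i :: nat and x :: "nat \<Rightarrow> real" and z :: "'c \<Rightarrow> nat \<Rightarrow> real" and Z :: real
  assume i: "i < width N (Suc l)" and Z: "1 \<le> Z"
    and x: "\<And>j. j < width N l \<Longrightarrow> \<bar>x j\<bar> \<le> Z"
    and z: "\<And>c j. j < width N l \<Longrightarrow> \<bar>z c j\<bar> \<le> Z"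
  have "\<bar>\<Sum>j<width N l. matA N (Suc l) $$ (i, j) * x j\<bar> \<le> (\<Sum>j<width N l. \<bar>matA N (Suc l) $$ (i, j)\<bar> * Z)"
    by (rule order.trans[OF sum_abs]) (auto simp: abs_mult intro!: sum_mono mult_left_mono x)
  moreover have "\<bar>\<Sum>c\<in>UNIV. \<Sum>j<width N l. matB N (Suc l) c $$ (i, j) * z c j\<bar>
      \<le> (\<Sum>c\<in>UNIV. \<Sum>j<width N l. \<bar>matB N (Suc l) c $$ (i, j)\<bar> * Z)"
    by (rule order.trans[OF sum_abs], rule sum_mono, rule order.trans[OF sum_abs])
      (auto simp: abs_mult intro!: sum_mono mult_left_mono z)
  moreover have "\<bar>bias N (Suc l) $ i\<bar> \<le> \<bar>bias N (Suc l) $ i\<bar> * Z"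
    using mult_left_mono[OF Z abs_ge_zero] by simp
  ultimately have "\<bar>affine N l i x z\<bar> \<le> w i * Z"
    unfolding affine_def w_def distrib_right sum_distrib_right by linarith
  also have "w i \<le> sum w {..<width N (Suc l)}"
    using i w0 by (intro member_le_sum) auto
  then have "w i * Z \<le> sum w {..<width N (Suc l)} * Z"
    using Z by (intro mult_right_mono) auto
  finally show "\<bar>affine N l i x z\<bar> \<le> sum w {..<width N (Suc l)} * Z" .
qed

section \<open>Satisfying the rule body\<close>

lemma finite_consts_atom: "finite (consts_atom A)"
proof -
  have "finite (consts_trm s)" for s by (cases s) auto
  then show ?thesis by (cases A) auto
qed

text \<open>Inequalities count as well, since the images of variables must also avoid the constants
  occurring only there.\<close>

fun consts_literal :: "'c literal \<Rightarrow> nat set" where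
  "consts_literal (Pos A) = consts_atom A"
| "consts_literal (Neq s t) = consts_trm s \<union> consts_trm t"

lemma finite_consts_literal: "finite (consts_literal B)"
proof -
  have "finite (consts_trm s)" for s by (cases s) auto
  then show ?thesis using finite_consts_atom by (cases B) auto
qed

lemma finite_vars_atom: "finite (vars_atom A)"
proof -
  have "finite (vars_trm s)" for s by (cases s) auto
  then show ?thesis by (cases A) auto
qed

lemma finite_vars_rule: "finite (vars_rule r)"
proof -
  have "finite (vars_trm s)" for s by (cases s) auto
  then have "finite (vars_literal B)" for B :: "'a literal"
    using finite_vars_atom by (cases B) auto
  then show ?thesis using finite_vars_atom by (auto simp: vars_rule_def)
qed

text \<open>The instantiated body itself serves as the dataset. Its inequalities hold because the
  substitution keeps distinct terms of the body distinct.\<close>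

lemma rule_match:
  fixes r :: "'c rule"
  assumes r: "is_rule \<delta> r" and head: "head r = Unary p s"
  shows "\<exists>\<nu> D0 a. finite (dom \<nu>) \<and> is_dataset \<delta> D0 \<and>
    (\<forall>B\<in>set (body r). holds D0 (subst_literal \<nu> B)) \<and> subst_trm \<nu> s = Const a"
proof -
  have "finite (\<Union>B\<in>set (body r). consts_literal B)"
    using finite_consts_literal by blast
  then obtain K where K: "(\<Union>B\<in>set (body r). consts_literal B) \<subseteq> {..<K}"
    unfolding finite_nat_set_iff_bounded subset_eq lessThan_iff by blast
  \<comment> \<open>All constants of the body are below \<open>K\<close>, so variables go
    injectively to constants not in the body.\<close>
  define \<nu> where "\<nu> x = (if x \<in> vars_rule r then Some (K + x) else None)" for x
  define D0 where "D0 = subst_atom \<nu> ` {A. Pos A \<in> set (body r)}"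
  have ground: "\<exists>b. subst_trm \<nu> u = Const b" if "vars_trm u \<subseteq> vars_rule r" for u
    using that by (cases u) (auto simp: \<nu>_def)
  have inj: "subst_trm \<nu> u \<noteq> subst_trm \<nu> v"
    if "u \<noteq> v" "vars_trm u \<subseteq> vars_rule r" "vars_trm v \<subseteq> vars_rule r"
      "consts_trm u \<subseteq> {..<K}" "consts_trm v \<subseteq> {..<K}" for u v
    using that by (cases u; cases v) (auto simp: \<nu>_def)
  have vars: "vars_literal B \<subseteq> vars_rule r" if "B \<in> set (body r)" for B
    using that by (auto simp: vars_rule_def)
  have "dom \<nu> = vars_rule r" by (auto simp: \<nu>_def dom_def)
  then have "finite (dom \<nu>)" by (simp add: finite_vars_rule)
  moreover have "is_dataset \<delta> D0"
  proof -
    have "finite {A. Pos A \<in> set (body r)}"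
      using finite_vimageI[of "set (body r)" Pos] by (simp add: inj_def vimage_def)
    moreover have "is_fact \<delta> (subst_atom \<nu> A)" if A: "Pos A \<in> set (body r)" for A
    proof -
      have wf: "wf_atom \<delta> A" using r A by (auto simp: is_rule_def)
      have V: "vars_atom A \<subseteq> vars_rule r" using vars[OF A] by simp
      show ?thesis
      proof (cases A)
        case (Unary q u)
        then show ?thesis using wf V ground[of u] by (auto simp: is_fact_def)
      next
        case (Binary c u v)
        then show ?thesis using wf V ground[of u] ground[of v] by (auto simp: is_fact_def)
      qed
    qed
    ultimately show ?thesis by (auto simp: is_dataset_def D0_def)
  qed
  moreover have "holds D0 (subst_literal \<nu> B)" if B: "B \<in> set (body r)" for B
  proof (cases B)
    case (Pos A)
    then show ?thesis using B by (auto simp: D0_def)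
  next
    case (Neq u v)
    have "u \<noteq> v" using r B Neq by (auto simp: is_rule_def)
    moreover have "vars_trm u \<subseteq> vars_rule r" "vars_trm v \<subseteq> vars_rule r"
      using vars[OF B] Neq by auto
    moreover have "consts_literal B \<subseteq> {..<K}" using K B by blast
    then have "consts_trm u \<subseteq> {..<K}" "consts_trm v \<subseteq> {..<K}" using Neq by auto
    ultimately show ?thesis using inj[of u v] ground[of u] ground[of v] Neq by auto
  qed
  moreover have "\<exists>a. subst_trm \<nu> s = Const a"
    using head by (intro ground) (auto simp: vars_rule_def)
  ultimately show ?thesis by blast
qed

section \<open>The gadget attached to the constant \<open>a\<close>, and its edges\<close>

locale pumping =
  fixes N :: "('c::finite) gnn" and \<delta> :: nat and D0 :: "'c atom set"
    and cs :: "nat \<Rightarrow> 'c" and y :: "real vec" and a M :: nat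
  assumes gnn: "is_sum_gnn \<delta> N"
    and act_relu: "\<And>l. \<lbrakk>1 \<le> l; l < n_layers N\<rbrakk> \<Longrightarrow> act N l = relu"
    and D0: "is_dataset \<delta> D0"
    and consts_D0: "(\<Union>A\<in>D0. consts_atom A) \<subseteq> {..<M}"
    and a_less: "a < M"
    and y: "y \<in> carrier_vec \<delta>" "\<And>i. i < \<delta> \<Longrightarrow> y $ i \<in> {0, 1}"
begin

text \<open>On the top level all indices collapse to \<open>a\<close>, so the root needs no separate
  treatment. The shift by \<open>M\<close> keeps the other nodes off \<open>D0\<close> and
  \<open>a\<close>, and \<open>prod_encode\<close> keeps them distinct from each other.\<close>

definition node :: "nat \<Rightarrow> nat \<Rightarrow> nat" where
  "node l m = (if l = n_layers N then a else M + prod_encode (l, m))"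

text \<open>Edges point down the levels because a vertex aggregates over its out-neighbours. At the
  top level the \<open>d\<close> values of \<open>k\<close> all produce the same edges out of
  \<open>a\<close>.\<close>

definition gadget :: "nat \<Rightarrow> 'c atom set" where
  "gadget d = (\<lambda>(l, k, m). Binary (cs (Suc l)) (Const (node (Suc l) k)) (Const (node l m))) `
       ({..<n_layers N} \<times> {..<d} \<times> {..<d}) \<union>
     (\<lambda>(q, m). Unary q (Const (node 0 m))) ` ({q. q < \<delta> \<and> y $ q = 1} \<times> {..<d})"

abbreviation G :: "nat \<Rightarrow> (nat, 'c) graph" where
  "G d \<equiv> enc \<delta> (D0 \<union> gadget d)"

lemma layers_pos: "1 \<le> n_layers N"
  using gnn by (simp add: is_sum_gnn_def)

lemma width_0: "width N 0 = \<delta>"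
  using gnn by (simp add: is_sum_gnn_def)

lemma node_fresh: "l < n_layers N \<Longrightarrow> M \<le> node l m"
  by (simp add: node_def)

lemma node_level:
  assumes "node l m = node l' m'" "l \<le> n_layers N" "l' \<le> n_layers N"
  shows "l = l'"
  using assms a_less by (auto simp: node_def split: if_splits)

lemma inj_node: "l < n_layers N \<Longrightarrow> inj (node l)"
  by (auto simp: node_def inj_def)

lemma is_dataset_pumped: "is_dataset \<delta> (D0 \<union> gadget d)"
proof -
  have "finite {q. q < \<delta> \<and> y $ q = 1}" by simp
  then show ?thesis
    using D0 unfolding is_dataset_def gadget_def by (auto simp: is_fact_def)
qed

lemmas is_graph_G = is_graph_enc[OF is_dataset_pumped]

lemma binary_D0_less:
  assumes "Binary c (Const u) (Const v) \<in> D0"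
  shows "u < M" "v < M"
  using assms consts_D0 by fastforce+

lemma binary_gadget_iff:
  "Binary c (Const v) (Const u) \<in> gadget d \<longleftrightarrow>
    (\<exists>l k m. l < n_layers N \<and> k < d \<and> m < d \<and> c = cs (Suc l) \<and> v = node (Suc l) k \<and> u = node l m)"
  unfolding gadget_def by force

definition out0 :: "'c \<Rightarrow> nat \<Rightarrow> nat set" where
  "out0 c v = {u. Binary c (Const v) (Const u) \<in> D0}"

lemma finite_out0: "finite (out0 c v)"
  by (rule finite_subset[of _ "{..<M}"]) (auto simp: out0_def binary_D0_less)

lemma card_out0: "card (out0 c v) \<le> card D0"
  using D0 by (intro card_inj_on_le[of "\<lambda>u. Binary c (Const v) (Const u)"])
    (auto simp: out0_def inj_on_def is_dataset_def)

text \<open>The part \<open>out0\<close> can be nonempty only at the root; keeping it for every node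
  lets one formula cover all levels.\<close>

lemma out_node:
  assumes "l < n_layers N" "k < d"
  shows "{u. (node (Suc l) k, u) \<in> edges (G d) c} =
    out0 c (node (Suc l) k) \<union> (if c = cs (Suc l) then node l ` {..<d} else {})"
  using assms by (auto simp: enc_def binary_gadget_iff out0_def dest!: node_level)

lemma out_other:
  assumes "\<nexists>l k. l < n_layers N \<and> k < d \<and> v = node (Suc l) k"
  shows "{u. (v, u) \<in> edges (G d) c} = out0 c v"
  using assms by (auto simp: enc_def binary_gadget_iff out0_def)

text \<open>Out-degrees are at most linear in \<open>d\<close>, which is why each layer contributes
  at most one further power of \<open>d\<close>.\<close>

lemma card_out:
  "card {u. (v, u) \<in> edges (G d) c} \<le> card D0 + d"
proof (cases "\<exists>l k. l < n_layers N \<and> k < d \<and> v = node (Suc l) k")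
  case True
  then obtain l k where lk: "l < n_layers N" "k < d" "v = node (Suc l) k" by blast
  have "card (if c = cs (Suc l) then node l ` {..<d} else {}) \<le> d"
    using card_image_le[of "{..<d}" "node l"] by simp
  then show ?thesis
    unfolding lk(3) out_node[OF lk(1,2)]
    using card_Un_le[of "out0 c (node (Suc l) k)" "if c = cs (Suc l) then node l ` {..<d} else {}"]
      card_out0[of c "node (Suc l) k"] by linarith
next
  case False
  then show ?thesis unfolding out_other[OF False] using card_out0[of c v] by simp
qed

lemma out_verts: "(v, u) \<in> edges (G d) c \<Longrightarrow> u \<in> verts (G d)"
  using is_graph_G[of d] by (auto simp: is_graph_def)

lemma gadget_edge:
  assumes "l < n_layers N" "k < d" "m < d"
  shows "(node (Suc l) k, node l m) \<in> edges (G d) (cs (Suc l))"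
proof -
  have "Binary (cs (Suc l)) (Const (node (Suc l) k)) (Const (node l m)) \<in> gadget d"
    unfolding binary_gadget_iff using assms by blast
  then show ?thesis by (simp add: enc_def)
qed

text \<open>\<open>enc\<close> has vertices only for constants occurring in facts. Nodes below the
  top are targets of gadget edges, and the root is a source of one.\<close>

lemma node_verts:
  assumes "l \<le> n_layers N" "m < d"
  shows "node l m \<in> verts (G d)"
proof (cases "l < n_layers N")
  case True
  then have "(node (Suc l) m, node l m) \<in> edges (G d) (cs (Suc l))"
    using assms by (intro gadget_edge)
  then show ?thesis by (rule out_verts)
next
  case False
  then obtain l' where l': "l = Suc l'" "l' < n_layers N"
    using assms layers_pos by (cases l) auto
  then have "(node l m, node l' m) \<in> edges (G d) (cs l)"
    using assms gadget_edge by simp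
  then show ?thesis using is_graph_G[of d] by (auto simp: is_graph_def)
qed

section \<open>Polynomial growth of all features in \<open>d\<close>\<close>

lemma feature_Suc_relu:
  assumes "Suc l < n_layers N" "v \<in> verts (G d)" "i < width N (Suc l)"
  shows "feature N (G d) (Suc l) v $ i = relu (pre N (G d) l v i)"
  using feature_Suc_index[OF gnn is_graph_G, of l v d i] act_relu[of "Suc l"] assms by simp

text \<open>Induction on the layer: a neighbour sum has at most \<open>card D0 + d\<close> terms,
  hence gains at most a factor of order \<open>d\<close>, and ReLU does not increase absolute
  values. The constant is chosen before \<open>d\<close>.\<close>

lemma feature_growth:
  assumes "l < n_layers N"
  shows "\<exists>C\<ge>0. \<forall>d\<ge>1. \<forall>v\<in>verts (G d). \<forall>j<width N l.
    \<bar>feature N (G d) l v $ j\<bar> \<le> C * real d ^ l"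
  using assms
proof (induction l)
  case 0
  show ?case
    by (rule exI[of _ 1]) (auto simp: enc_def width_0)
next
  case (Suc l)
  then obtain C where C: "C \<ge> 0" and bd: "\<And>d v j. \<lbrakk>d \<ge> 1; v \<in> verts (G d); j < width N l\<rbrakk> \<Longrightarrow>
    \<bar>feature N (G d) l v $ j\<bar> \<le> C * real d ^ l"
    by auto
  obtain W where W: "W \<ge> 0" and aff:
    "\<And>i x z Z. \<lbrakk>i < width N (Suc l); 1 \<le> Z; \<And>j. j < width N l \<Longrightarrow> \<bar>x j\<bar> \<le> Z;
      \<And>c j. j < width N l \<Longrightarrow> \<bar>z c j\<bar> \<le> Z\<rbrakk> \<Longrightarrow> \<bar>affine N l i x z\<bar> \<le> W * Z"
    using affine_bound[of N l] by blast
  \<comment> \<open>\<open>card D0 + 1\<close> comes from the degree bound; \<open>C + 1\<close>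
    instead of \<open>C\<close> ensures \<open>1 \<le> K\<close>, as \<open>affine_bound\<close>
    demands of \<open>Z\<close>.\<close>
  define K where "K = (real (card D0) + 1) * (C + 1)"
  have "\<bar>feature N (G d) (Suc l) v $ i\<bar> \<le> (W * K) * real d ^ Suc l"
    if d: "d \<ge> 1" and v: "v \<in> verts (G d)" and i: "i < width N (Suc l)" for d v i
  proof -
    define Z where "Z = K * real d ^ Suc l"
    have dl: "1 \<le> real d ^ l" "1 \<le> real d" "real d ^ l \<le> real d ^ Suc l"
      using d by (auto intro: power_increasing)
    have K1: "1 \<le> K" "C \<le> K"
      using mult_mono[of 1 "real (card D0) + 1" 1 "C + 1"]
        mult_mono[of 1 "real (card D0) + 1" C "C + 1"] C by (auto simp: K_def)
    have Z1: "1 \<le> Z"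
      using mult_mono[of 1 K 1 "real d ^ Suc l"] K1 dl unfolding Z_def by linarith
    have self: "\<bar>feature N (G d) l v $ j\<bar> \<le> Z" if "j < width N l" for j
    proof -
      have "C * real d ^ l \<le> Z"
        unfolding Z_def using K1 dl C by (intro mult_mono) auto
      then show ?thesis using bd[OF d v that] by linarith
    qed
    have out: "\<bar>\<Sum>u | (v, u) \<in> edges (G d) c. feature N (G d) l u $ j\<bar> \<le> Z"
      if j: "j < width N l" for c j
    proof -
      have "\<bar>\<Sum>u | (v, u) \<in> edges (G d) c. feature N (G d) l u $ j\<bar>
          \<le> (\<Sum>u | (v, u) \<in> edges (G d) c. C * real d ^ l)"
      proof (rule order.trans[OF sum_abs], rule sum_mono)
        fix u assume "u \<in> {u. (v, u) \<in> edges (G d) c}"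
        then show "\<bar>feature N (G d) l u $ j\<bar> \<le> C * real d ^ l" using bd[OF d out_verts j] by blast
      qed
      also have "\<dots> = real (card {u. (v, u) \<in> edges (G d) c}) * (C * real d ^ l)"
        by simp
      also have "real (card {u. (v, u) \<in> edges (G d) c}) \<le> real (card D0) + real d"
        using card_out[of v d c] by linarith
      also have "real (card D0) + real d \<le> (real (card D0) + 1) * real d"
        using mult_left_mono[OF dl(2), of "real (card D0)"] by (simp add: algebra_simps)
      also have "(real (card D0) + 1) * real d * (C * real d ^ l) =
          (real (card D0) + 1) * C * real d ^ Suc l"
        by simp
      also have "\<dots> \<le> Z"
        unfolding Z_def K_def by (intro mult_right_mono mult_left_mono) auto
      finally show ?thesis using C by (simp add: mult_right_mono)
    qed
    have "\<bar>pre N (G d) l v i\<bar> \<le> W * Z"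
      unfolding pre_def by (rule aff[OF i Z1 self out])
    then have "\<bar>relu (pre N (G d) l v i)\<bar> \<le> W * Z"
      by (auto simp: relu_def)
    then show ?thesis
      using feature_Suc_relu[OF Suc.prems v i] by (simp add: Z_def mult.assoc)
  qed
  moreover have "W * K \<ge> 0" using W C by (simp add: K_def)
  ultimately show ?case by blast
qed

section \<open>Leading terms along the levels of the gadget\<close>

abbreviation chain :: "nat \<Rightarrow> real vec" where
  "chain l \<equiv> relu_chain N cs y l"

lemma chain_carrier: "l \<le> n_layers N \<Longrightarrow> chain l \<in> carrier_vec (width N l)"
proof (induction l)
  case 0
  then show ?case using y(1) by (simp add: width_0)
next
  case (Suc l)
  then show ?case
    using mult_mat_vec_carrier[OF gnn_carriers(2)[OF gnn Suc.prems] Suc.IH] by simp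
qed

text \<open>The \<open>d\<close> gadget neighbours each have feature \<open>d^l * chain l\<close> up
  to O(d^(l-1)), so they sum to \<open>d^(l+1) * chain l\<close> up to O(d^l). Bias, own feature and
  the at most \<open>card D0\<close> old neighbours per colour also contribute O(d^l). This serves
  both the induction over the levels and the root.\<close>

lemma pre_asymptotic:
  assumes l: "l < n_layers N"
    and IH: "\<exists>C\<ge>0. \<forall>d\<ge>1. \<forall>m<d. \<forall>j<width N l.
      real d * \<bar>feature N (G d) l (node l m) $ j - real d ^ l * chain l $ j\<bar> \<le> C * real d ^ l"
  shows "\<exists>C\<ge>0. \<forall>d\<ge>1. \<forall>k<d. \<forall>i<width N (Suc l).
    \<bar>pre N (G d) l (node (Suc l) k) i - real d ^ Suc l * (matB N (Suc l) (cs (Suc l)) *\<^sub>v chain l) $ i\<bar>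
      \<le> C * real d ^ l"
proof -
  obtain C where C: "C \<ge> 0" and err: "\<And>d m j. \<lbrakk>d \<ge> 1; m < d; j < width N l\<rbrakk> \<Longrightarrow>
    real d * \<bar>feature N (G d) l (node l m) $ j - real d ^ l * chain l $ j\<bar> \<le> C * real d ^ l"
    using IH by auto
  obtain C1 where C1: "C1 \<ge> 0" and bd: "\<And>d v j. \<lbrakk>d \<ge> 1; v \<in> verts (G d); j < width N l\<rbrakk> \<Longrightarrow>
    \<bar>feature N (G d) l v $ j\<bar> \<le> C1 * real d ^ l"
    using feature_growth[OF l] by auto
  obtain W where W: "W \<ge> 0" and aff:
    "\<And>i x z Z. \<lbrakk>i < width N (Suc l); 1 \<le> Z; \<And>j. j < width N l \<Longrightarrow> \<bar>x j\<bar> \<le> Z;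
      \<And>c j. j < width N l \<Longrightarrow> \<bar>z c j\<bar> \<le> Z\<rbrakk> \<Longrightarrow> \<bar>affine N l i x z\<bar> \<le> W * Z"
    using affine_bound[of N l] by blast
  \<comment> \<open>The summands account for old neighbours, the vertex's own feature, the error
    from the gadget neighbours, and \<open>1 \<le> Z\<close>.\<close>
  define K where "K = real (card D0) * C1 + C1 + C + 1"
  have K: "1 \<le> K" "C1 \<le> K" "real (card D0) * C1 + C \<le> K"
    using C C1 by (auto simp: K_def)
  have "\<bar>pre N (G d) l (node (Suc l) k) i -
      real d ^ Suc l * (matB N (Suc l) (cs (Suc l)) *\<^sub>v chain l) $ i\<bar> \<le> (W * K) * real d ^ l"
    if d: "d \<ge> 1" and k: "k < d" and i: "i < width N (Suc l)" for d k i
  proof -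
    define v where "v = node (Suc l) k"
    define Z where "Z = K * real d ^ l"
    \<comment> \<open>The leading term of the neighbour sum for colour \<open>cs (Suc l)\<close>;
      after its removal all arguments of \<open>affine\<close> are bounded by
      \<open>Z\<close>.\<close>
    define w where "w j = real d ^ Suc l * chain l $ j" for j
    let ?F = "\<lambda>u j. feature N (G d) l u $ j"
    have dl: "1 \<le> real d ^ l" using d by simp
    have Z1: "1 \<le> Z"
      using mult_mono[of 1 K 1 "real d ^ l"] K dl unfolding Z_def by linarith
    have v: "v \<in> verts (G d)" unfolding v_def using l k by (intro node_verts) auto
    have self: "\<bar>?F v j\<bar> \<le> Z" if "j < width N l" for j
    proof -
      have "C1 * real d ^ l \<le> Z"
        unfolding Z_def using K dl by (intro mult_right_mono) auto
      then show ?thesis using bd[OF d v that] by linarith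
    qed
    have out: "\<bar>(\<Sum>u | (v, u) \<in> edges (G d) c. ?F u j) - (if c = cs (Suc l) then w j else 0)\<bar> \<le> Z"
      if j: "j < width N l" for c j
    proof -
      have outv: "{u. (v, u) \<in> edges (G d) c} =
          out0 c v \<union> (if c = cs (Suc l) then node l ` {..<d} else {})"
        unfolding v_def by (rule out_node[OF l k])
      have "\<bar>\<Sum>u\<in>out0 c v. ?F u j\<bar> \<le> (\<Sum>u\<in>out0 c v. C1 * real d ^ l)"
      proof (rule order.trans[OF sum_abs], rule sum_mono)
        fix u assume "u \<in> out0 c v"
        then have "(v, u) \<in> edges (G d) c" using outv by blast
        then show "\<bar>?F u j\<bar> \<le> C1 * real d ^ l" using bd[OF d out_verts j] by blast
      qed
      also have "\<dots> = real (card (out0 c v)) * (C1 * real d ^ l)" by simp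
      also have "\<dots> \<le> real (card D0) * (C1 * real d ^ l)"
        using card_out0[of c v] C1 by (intro mult_right_mono) auto
      finally have old: "\<bar>\<Sum>u\<in>out0 c v. ?F u j\<bar> \<le> real (card D0) * C1 * real d ^ l"
        by (simp add: mult.assoc)
      have new: "\<bar>(\<Sum>u\<in>node l ` {..<d}. ?F u j) - w j\<bar> \<le> C * real d ^ l"
      proof -
        have "(\<Sum>u\<in>node l ` {..<d}. ?F u j) = (\<Sum>m<d. ?F (node l m) j)"
          using inj_node[OF l] by (subst sum.reindex) (auto intro: inj_on_subset)
        then have "(\<Sum>u\<in>node l ` {..<d}. ?F u j) - w j =
            (\<Sum>m<d. ?F (node l m) j - real d ^ l * chain l $ j)"
          by (simp add: sum_subtractf w_def)
        \<comment> \<open>Each of the \<open>d\<close> errors is at most a \<open>d\<close>-th part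
          of the total allowed.\<close>
        also have "\<bar>\<dots>\<bar> \<le> (\<Sum>m<d. C * real d ^ l / real d)"
        proof (rule order.trans[OF sum_abs], rule sum_mono)
          fix m assume "m \<in> {..<d}"
          then show "\<bar>?F (node l m) j - real d ^ l * chain l $ j\<bar> \<le> C * real d ^ l / real d"
            using err[OF d _ j, of m] d by (simp add: pos_le_divide_eq mult.commute)
        qed
        also have "\<dots> = C * real d ^ l" using d by simp
        finally show ?thesis .
      qed
      \<comment> \<open>Old neighbours lie below \<open>M\<close>, while nodes of level
        \<open>l\<close>, being below the top level, lie at or above it.\<close>
      have disj: "out0 c v \<inter> node l ` {..<d} = {}"
      proof -
        have "u < M" if "u \<in> out0 c v" for u
          using that binary_D0_less(2) by (auto simp: out0_def)
        then show ?thesis using node_fresh[OF l] by (fastforce simp: not_less[symmetric])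
      qed
      have "\<bar>(\<Sum>u | (v, u) \<in> edges (G d) c. ?F u j) - (if c = cs (Suc l) then w j else 0)\<bar>
          \<le> real (card D0) * C1 * real d ^ l + C * real d ^ l"
      proof (cases "c = cs (Suc l)")
        case True
        have "(\<Sum>u | (v, u) \<in> edges (G d) c. ?F u j) =
            (\<Sum>u\<in>out0 c v. ?F u j) + (\<Sum>u\<in>node l ` {..<d}. ?F u j)"
          unfolding outv using True disj finite_out0 by (simp add: sum.union_disjoint)
        then show ?thesis using True old new by simp
      next
        case False
        then show ?thesis unfolding outv using old C dl by (simp add: add_increasing2)
      qed
      also have "\<dots> = (real (card D0) * C1 + C) * real d ^ l"
        by (simp add: distrib_right)
      also have "\<dots> \<le> Z"
        unfolding Z_def using K dl by (intro mult_right_mono) auto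
      finally show ?thesis .
    qed
    have "real d ^ Suc l * (matB N (Suc l) (cs (Suc l)) *\<^sub>v chain l) $ i =
        (\<Sum>j<width N l. matB N (Suc l) (cs (Suc l)) $$ (i, j) * w j)"
      using l i chain_carrier[of l]
      by (subst index_mult_mat_vec_sum[OF gnn_carriers(2)[OF gnn]])
        (auto simp: w_def sum_distrib_left mult_ac)
    then have "pre N (G d) l v i - real d ^ Suc l * (matB N (Suc l) (cs (Suc l)) *\<^sub>v chain l) $ i =
        affine N l i (?F v) (\<lambda>c j. (\<Sum>u | (v, u) \<in> edges (G d) c. ?F u j) -
          (if c = cs (Suc l) then w j else 0))"
      unfolding pre_def by (simp only: affine_diff)
    also have "\<bar>\<dots>\<bar> \<le> W * Z"
      by (rule aff[OF i Z1 self out])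
    finally show ?thesis by (simp add: v_def Z_def mult.assoc)
  qed
  moreover have "W * K \<ge> 0" using W K by simp
  ultimately show ?thesis by blast
qed

text \<open>
  The factor \<open>real d\<close> on the left stands for the exponent \<open>l - 1\<close> on the right, which would be
  truncated at \<open>l = 0\<close>.
\<close>

lemma node_feature_asymptotic:
  assumes "l < n_layers N"
  shows "\<exists>C\<ge>0. \<forall>d\<ge>1. \<forall>m<d. \<forall>j<width N l.
    real d * \<bar>feature N (G d) l (node l m) $ j - real d ^ l * chain l $ j\<bar> \<le> C * real d ^ l"
  using assms
proof (induction l)
  case 0
  have "Unary q (Const (node 0 m)) \<in> D0 \<union> gadget d \<longleftrightarrow> y $ q = 1"
    if "m < d" "q < \<delta>" for d m q
  proof -
    have "Unary q (Const (node 0 m)) \<notin> D0"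
      using consts_D0 node_fresh[of 0 m] layers_pos by fastforce
    moreover have "Unary q (Const (node 0 m)) \<in> gadget d \<longleftrightarrow> y $ q = 1"
      using that inj_node[of 0] layers_pos by (auto simp: gadget_def)
    ultimately show ?thesis by simp
  qed
  \<comment> \<open>On level 0 the labels encode \<open>y\<close> exactly, so the error constant is
    0.\<close>
  then have "feature N (G d) 0 (node 0 m) $ j = chain 0 $ j" if "m < d" "j < width N 0" for d m j
    using that y(2)[of j] by (auto simp: enc_def width_0)
  then show ?case by (intro exI[of _ 0]) auto
next
  case (Suc l)
  then obtain C where C: "C \<ge> 0" and err: "\<And>d k i. \<lbrakk>d \<ge> 1; k < d; i < width N (Suc l)\<rbrakk> \<Longrightarrow>
    \<bar>pre N (G d) l (node (Suc l) k) i - real d ^ Suc l * (matB N (Suc l) (cs (Suc l)) *\<^sub>v chain l) $ i\<bar>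
      \<le> C * real d ^ l"
    using pre_asymptotic[of l] by auto
  have "real d * \<bar>feature N (G d) (Suc l) (node (Suc l) k) $ i - real d ^ Suc l * chain (Suc l) $ i\<bar>
      \<le> C * real d ^ Suc l" if d: "d \<ge> 1" and k: "k < d" and i: "i < width N (Suc l)" for d k i
  proof -
    let ?b = "(matB N (Suc l) (cs (Suc l)) *\<^sub>v chain l) $ i"
    let ?x = "pre N (G d) l (node (Suc l) k) i"
    have v: "node (Suc l) k \<in> verts (G d)"
      using Suc.prems k by (intro node_verts) auto
    have "chain (Suc l) $ i = relu ?b"
      using i gnn_carriers(2)[OF gnn, of l "cs (Suc l)"] Suc.prems by simp
    \<comment> \<open>ReLU commutes with nonnegative factors, which pulls the power of
      \<open>d\<close> inside; being 1-Lipschitz, it then passes on the error bound for its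
      argument.\<close>
    moreover have "real d ^ Suc l * relu ?b = relu (real d ^ Suc l * ?b)"
      by (simp add: relu_def max_mult_distrib_left)
    ultimately have "\<bar>feature N (G d) (Suc l) (node (Suc l) k) $ i - real d ^ Suc l * chain (Suc l) $ i\<bar>
        = \<bar>relu ?x - relu (real d ^ Suc l * ?b)\<bar>"
      using feature_Suc_relu[OF Suc.prems v i] by simp
    also have "\<dots> \<le> \<bar>?x - real d ^ Suc l * ?b\<bar>"
      by (auto simp: relu_def max_def)
    also have "\<dots> \<le> C * real d ^ l"
      by (rule err[OF d k i])
    finally have "real d * \<bar>feature N (G d) (Suc l) (node (Suc l) k) $ i - real d ^ Suc l * chain (Suc l) $ i\<bar>
        \<le> real d * (C * real d ^ l)"
      by (rule mult_left_mono) simp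
    also have "\<dots> = C * real d ^ Suc l" by simp
    finally show ?thesis .
  qed
  with C show ?case by blast
qed

text \<open>At the root the leading term is \<open>- e * d^(l+1)\<close> with \<open>e > 0\<close>,
  and it beats the error O(d^l).\<close>

lemma pre_root_unbounded_below:
  assumes p: "p < width N (n_layers N)"
    and neg: "(matB N (n_layers N) (cs (n_layers N)) *\<^sub>v chain (n_layers N - 1)) $ p < 0"
  shows "\<exists>d\<ge>1. pre N (G d) (n_layers N - 1) a p \<le> x"
proof -
  obtain l where L: "n_layers N = Suc l"
    using layers_pos by (cases "n_layers N") auto
  define e where "e = - (matB N (n_layers N) (cs (n_layers N)) *\<^sub>v chain (n_layers N - 1)) $ p"
  have e: "e > 0" using neg by (simp add: e_def)
  have l: "l < n_layers N" using L by simp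
  obtain C where C: "C \<ge> 0" and err: "\<And>d k i. \<lbrakk>d \<ge> 1; k < d; i < width N (Suc l)\<rbrakk> \<Longrightarrow>
    \<bar>pre N (G d) l (node (Suc l) k) i - real d ^ Suc l * (matB N (Suc l) (cs (Suc l)) *\<^sub>v chain l) $ i\<bar>
      \<le> C * real d ^ l"
    using pre_asymptotic[OF l node_feature_asymptotic[OF l]] by auto
  \<comment> \<open>Chosen so that \<open>C - e * d\<close> is at most
    \<open>- \<bar>x\<bar>\<close>; since \<open>d^l\<close> is at least 1, multiplying by it only
    lowers this bound.\<close>
  obtain d :: nat where d0: "real d \<ge> max 1 ((C + \<bar>x\<bar>) / e)"
    using real_arch_simple by blast
  then have d: "d \<ge> 1" "e * real d \<ge> C + \<bar>x\<bar>"
    using e by (auto simp: pos_divide_le_eq mult.commute)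
  \<comment> \<open>Any index below \<open>d\<close> would do at the top level; 0 is available
    because \<open>d \<ge> 1\<close>.\<close>
  have "node (Suc l) 0 = a" using L by (simp add: node_def)
  then have "pre N (G d) l a p \<le> C * real d ^ l - e * real d ^ Suc l"
    using err[of d 0 p] d p L by (simp add: e_def mult_ac)
  also have "\<dots> = real d ^ l * (C - e * real d)"
    by (simp add: algebra_simps)
  also have "\<dots> \<le> real d ^ l * (- \<bar>x\<bar>)"
    using d by (intro mult_left_mono) auto
  also have "\<dots> \<le> x"
    using mult_right_mono[of 1 "real d ^ l" "\<bar>x\<bar>"] d by simp
  finally show ?thesis using d L by auto
qed

end

section \<open>The counterexample dataset for the rule\<close>

theorem theorem10:
  fixes N :: "('c::finite) gnn" and \<delta> p :: nat and r :: "'c rule" and s :: trm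
  assumes "\<delta> \<ge> 1"
    and "is_sum_gnn \<delta> N"
    and "\<forall>l\<in>{1..n_layers N - 1}. act N l = relu"
    and "\<exists>z\<in>range (act N (n_layers N)). z < threshold N"
    and "p < width N (n_layers N)"
    and "unbounded_channel N p"
    and "is_rule \<delta> r"
    and "head r = Unary p s"
  shows "\<exists>D. is_dataset \<delta> D \<and> \<not> T_rule r D \<subseteq> T_gnn \<delta> N D"
proof -
  obtain y cs where y: "y \<in> carrier_vec (width N 0)" "\<forall>i<width N 0. y $ i \<in> {0, 1}"
    and neg: "(matB N (n_layers N) (cs (n_layers N)) *\<^sub>v relu_chain N cs y (n_layers N - 1)) $ p < 0"
    using assms(6) unfolding unbounded_channel_def by blast
  have w0: "width N 0 = \<delta>" using assms(2) by (simp add: is_sum_gnn_def)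
  obtain \<nu> D0 a where \<nu>: "finite (dom \<nu>)" and D0: "is_dataset \<delta> D0"
    and body: "\<And>B. B \<in> set (body r) \<Longrightarrow> holds D0 (subst_literal \<nu> B)"
    and a: "subst_trm \<nu> s = Const a"
    using rule_match[OF assms(7,8)] by blast
  have fin: "finite (insert a (\<Union>A\<in>D0. consts_atom A))"
    using D0 finite_consts_atom by (auto simp: is_dataset_def)
  \<comment> \<open>\<open>a\<close> is inserted because it need not occur in \<open>D0\<close>: the
    head term may be a constant absent from the body.\<close>
  obtain M where M: "insert a (\<Union>A\<in>D0. consts_atom A) \<subseteq> {..<M}"
    using fin unfolding finite_nat_set_iff_bounded subset_eq lessThan_iff by blast
  interpret pumping N \<delta> D0 cs y a M
    using assms(2,3) D0 M y w0 by unfold_locales auto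
  \<comment> \<open>Monotonicity turns this one value below the threshold into a bound for every
    argument at most \<open>x\<close>.\<close>
  obtain x where x: "act N (n_layers N) x < threshold N" using assms(4) by auto
  obtain d where d: "d \<ge> 1" "pre N (G d) (n_layers N - 1) a p \<le> x"
    using pre_root_unbounded_below[OF assms(5) neg] by blast
  let ?D = "D0 \<union> gadget d"
  \<comment> \<open>Adding facts preserves the body: atoms occur only positively, and inequalities
    do not depend on the dataset.\<close>
  have "holds ?D (subst_literal \<nu> B)" if "B \<in> set (body r)" for B
    using body[OF that] by (cases B) auto
  then have derived: "Unary p (Const a) \<in> T_rule r ?D"
    unfolding T_rule_def using \<nu> a assms(8) by (auto intro!: exI[of _ \<nu>])
  have "a = node (n_layers N) 0" by (simp add: node_def)
  then have av: "a \<in> verts (G d)" using node_verts[of "n_layers N" 0 d] d by simp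
  have mono: "mono (act N (n_layers N))"
    using assms(2) layers_pos by (auto simp: is_sum_gnn_def)
  have "feature N (G d) (n_layers N) a $ p = act N (n_layers N) (pre N (G d) (n_layers N - 1) a p)"
    using feature_Suc_index[OF gnn is_graph_G, of "n_layers N - 1" a d p] layers_pos av assms(5) by simp
  also have "\<dots> < threshold N"
    using monoD[OF mono d(2)] x by linarith
  finally have "cls (threshold N) (feature N (G d) (n_layers N) a $ p) = 0"
    by (simp add: cls_def)
  moreover have "feature N (G d) (n_layers N) a \<in> carrier_vec (width N (n_layers N))"
    by (rule feature_carrier[OF gnn is_graph_G order.refl av])
  ultimately have "Unary p (Const a) \<notin> T_gnn \<delta> N ?D"
    using assms(5) by (auto simp: T_gnn_def dec_def apply_gnn_def)
  with derived show ?thesis using is_dataset_pumped by blast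
qed

end
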